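(* Every non-trivial graph $G$ has a $T$-partition of width at most $2(\operatorname{tw}(G)+1)(9\Delta(G)-1)$ for some tree $T$ with $\Delta(T)\leq 6\Delta(G)$.
   Context: All graphs are finite and simple. A graph $G$ is non-trivial if $E(G)\neq\emptyset$. $\Delta(G)$ denotes the maximum degree of $G$, and $\operatorname{tw}(G)$ its treewidth. For a graph $G$ and a tree $T$, a $T$-partition of $G$ is a family $(V_x : x\in V(T))$ of pairwise disjoint subsets of $V(G)$ (some possibly empty) with union $V(G)$, indexed by the nodes of $T$, such that for every edge $vw$ of $G$, if $v\in V_x$ and $w\in V_y$ then $x=y$ or $xy\in E(T)$. The width of a $T$-partition is $\max\{|V_x| : x\in V(T)\}$. *)

theory Defs
  imports Main
begin

definition graph :: "'a set \<Rightarrow> 'a set set \<Rightarrow> bool" where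
  "graph V E \<longleftrightarrow> finite V \<and> (\<forall>e\<in>E. \<exists>u v. e = {u, v} \<and> u \<noteq> v \<and> u \<in> V \<and> v \<in> V)"

definition degree :: "'a set set \<Rightarrow> 'a \<Rightarrow> nat" where
  "degree E v = card {e \<in> E. v \<in> e}"

definition max_degree :: "'a set \<Rightarrow> 'a set set \<Rightarrow> nat" where
  "max_degree V E = Max (degree E ` V)"

definition connected_on :: "'a set set \<Rightarrow> 'a set \<Rightarrow> bool" where
  "connected_on E S \<longleftrightarrow>
     (\<forall>u\<in>S. \<forall>v\<in>S. (\<lambda>x y. x \<in> S \<and> y \<in> S \<and> {x, y} \<in> E)\<^sup>*\<^sup>* u v)"

definition has_cycle :: "'a set \<Rightarrow> 'a set set \<Rightarrow> bool" where
  "has_cycle V E \<longleftrightarrow> (\<exists>xs. length xs \<ge> 3 \<and> distinct xs \<and> set xs \<subseteq> V \<and>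
      (\<forall>i. Suc i < length xs \<longrightarrow> {xs ! i, xs ! Suc i} \<in> E) \<and> {last xs, hd xs} \<in> E)"

definition tree :: "'b set \<Rightarrow> 'b set set \<Rightarrow> bool" where
  "tree V E \<longleftrightarrow> graph V E \<and> V \<noteq> {} \<and> connected_on E V \<and> \<not> has_cycle V E"

definition tree_decomposition ::
  "'a set \<Rightarrow> 'a set set \<Rightarrow> 'b set \<Rightarrow> 'b set set \<Rightarrow> ('b \<Rightarrow> 'a set) \<Rightarrow> bool" where
  "tree_decomposition V E VT ET B \<longleftrightarrow>
     tree VT ET \<and>
     (\<forall>x\<in>VT. B x \<subseteq> V) \<and>
     (\<forall>v\<in>V. \<exists>x\<in>VT. v \<in> B x) \<and>
     (\<forall>e\<in>E. \<exists>x\<in>VT. e \<subseteq> B x) \<and>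
     (\<forall>v\<in>V. connected_on ET {x \<in> VT. v \<in> B x})"

text \<open>Width of a tree decomposition is max bag size minus one; treewidth is the
minimum width. Trees are represented with node type nat (w.l.o.g.).\<close>
definition treewidth :: "'a set \<Rightarrow> 'a set set \<Rightarrow> nat" where
  "treewidth V E = (LEAST k. \<exists>(VT::nat set) ET B.
      tree_decomposition V E VT ET B \<and> (\<forall>x\<in>VT. card (B x) \<le> k + 1))"

definition T_partition ::
  "'a set \<Rightarrow> 'a set set \<Rightarrow> 'b set \<Rightarrow> 'b set set \<Rightarrow> ('b \<Rightarrow> 'a set) \<Rightarrow> bool" where
  "T_partition V E VT ET P \<longleftrightarrow>
     (\<forall>x\<in>VT. \<forall>y\<in>VT. x \<noteq> y \<longrightarrow> P x \<inter> P y = {}) \<and>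
     (\<Union>x\<in>VT. P x) = V \<and>
     (\<forall>v w x y. {v, w} \<in> E \<longrightarrow> x \<in> VT \<longrightarrow> y \<in> VT \<longrightarrow> v \<in> P x \<longrightarrow> w \<in> P y \<longrightarrow>
        x = y \<or> {x, y} \<in> ET)"

definition partition_width :: "'b set \<Rightarrow> ('b \<Rightarrow> 'a set) \<Rightarrow> nat" where
  "partition_width VT P = Max ((\<lambda>x. card (P x)) ` VT)"

end

theory Submission
  imports Defs "HOL-Library.Disjoint_Sets"
begin

text \<open>
Write \<open>k = tw(G) + 1\<close> and \<open>d = \<Delta>(G)\<close>. For every vertex set \<open>S\<close> of an induced subgraph with
\<open>4k \<le> |S| \<le> 12kd\<close> one finds, by induction on the number of vertices, a tree-partition whose root
bag \<open>Z\<close> contains \<open>S\<close>, has at most \<open>3|S|/2 - 2k\<close> vertices and at most \<open>|S|/(2k) - 1\<close> children, all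
other bags having at most \<open>18kd - 2k\<close> vertices and fewer than \<open>6d\<close> children. If few vertices lie
outside \<open>S\<close>, they form a single further bag. If \<open>|S| \<le> 12k\<close>, then \<open>S\<close> becomes a root above the
partition of \<open>G - S\<close> obtained for the neighbourhood of \<open>S\<close>, enlarged to \<open>4k\<close> vertices if necessary.
If \<open>|S| > 12k\<close>, a bag of an optimal tree decomposition yields a separation of order at most \<open>k\<close> with
at most \<open>2|S|/3\<close> vertices of \<open>S\<close> strictly on either side; both sides are partitioned by induction,
with the separator added to their share of \<open>S\<close>, and the two root bags are merged. The terms \<open>-2k\<close>
and \<open>-1\<close> in the bounds on the root pay for the separator being counted twice.
\<close>

section \<open>Trees given by parent functions\<close>

lemma obtain_greatest_nat:
  fixes f :: "'c \<Rightarrow> nat"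
  assumes "P a" "\<And>y. P y \<Longrightarrow> f y \<le> b"
  obtains x where "P x" "\<And>y. P y \<Longrightarrow> f y \<le> f x"
proof -
  have "\<exists>x. P x \<and> (\<forall>y. P y \<longrightarrow> f y \<le> f x)"
    using assms by (intro ex_has_greatest_nat[of P a f "Suc b"]) (auto simp: less_Suc_eq_le)
  then show thesis using that by blast
qed

text \<open>The height \<open>h\<close> is a certificate that iterating \<open>p\<close> reaches
  \<open>r\<close>, not the distance to the root. As it only has to drop along \<open>p\<close>,
  combined trees may use any convenient heights.\<close>

definition rooted_tree :: "'b set \<Rightarrow> 'b \<Rightarrow> ('b \<Rightarrow> 'b) \<Rightarrow> ('b \<Rightarrow> nat) \<Rightarrow> bool" where
  "rooted_tree N r p h \<longleftrightarrow> finite N \<and> r \<in> N \<and> (\<forall>x\<in>N - {r}. p x \<in> N \<and> h (p x) < h x)"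

definition parent_edges :: "'b set \<Rightarrow> 'b \<Rightarrow> ('b \<Rightarrow> 'b) \<Rightarrow> 'b set set" where
  "parent_edges N r p = (\<lambda>x. {x, p x}) ` (N - {r})"

lemma parent_edges_iff:
  "{x, y} \<in> parent_edges N r p \<longleftrightarrow> (x \<in> N - {r} \<and> y = p x) \<or> (y \<in> N - {r} \<and> x = p y)"
  unfolding parent_edges_def by (auto simp: doubleton_eq_iff)

lemma graph_parent_edges:
  assumes "rooted_tree N r p h"
  shows "graph N (parent_edges N r p)"
proof -
  have "\<exists>u v. {x, p x} = {u, v} \<and> u \<noteq> v \<and> u \<in> N \<and> v \<in> N" if "x \<in> N - {r}" for x
  proof (intro exI conjI)
    have "h (p x) < h x" and "p x \<in> N"
      using assms that unfolding rooted_tree_def by auto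
    then show "x \<noteq> p x" "p x \<in> N" by auto
  qed (use that in auto)
  then show ?thesis
    using assms unfolding graph_def parent_edges_def rooted_tree_def by blast
qed

lemma connected_parent_edges:
  assumes "rooted_tree N r p h"
  shows "connected_on (parent_edges N r p) N"
proof -
  let ?R = "\<lambda>x y. x \<in> N \<and> y \<in> N \<and> {x, y} \<in> parent_edges N r p"
  have to_root: "?R\<^sup>*\<^sup>* x r" if "x \<in> N" for x
    using that
  proof (induction "h x" arbitrary: x rule: less_induct)
    case less
    show ?case
    proof (cases "x = r")
      case False
      then have p: "p x \<in> N" "h (p x) < h x"
        using assms less.prems unfolding rooted_tree_def by auto
      then have "?R x (p x)"
        using False less.prems by (auto simp: parent_edges_iff)
      then show ?thesis
        using less.hyps[OF p(2,1)] by (rule converse_rtranclp_into_rtranclp)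
    qed simp
  qed
  have "symp ?R"
    by (auto simp: symp_def insert_commute)
  then have "symp ?R\<^sup>*\<^sup>*"
    by (rule symp_rtranclp)
  then have "?R\<^sup>*\<^sup>* r x" if "x \<in> N" for x
    using to_root[OF that] by (auto dest: sympD)
  then show ?thesis
    using to_root unfolding connected_on_def by (meson rtranclp_trans)
qed

text \<open>A highest vertex of a cycle would have two different parents.\<close>

lemma acyclic_parent_edges:
  assumes "rooted_tree N r p h"
  shows "\<not> has_cycle N (parent_edges N r p)"
proof
  assume "has_cycle N (parent_edges N r p)"
  then obtain xs where len: "length xs \<ge> 3" and dist: "distinct xs" and sub: "set xs \<subseteq> N"
    and step: "\<And>i. Suc i < length xs \<Longrightarrow> {xs ! i, xs ! Suc i} \<in> parent_edges N r p"
    and close: "{last xs, hd xs} \<in> parent_edges N r p"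
    unfolding has_cycle_def by blast
  let ?n = "length xs"
  have "\<exists>i<?n. \<forall>j<?n. h (xs ! j) \<le> h (xs ! i)"
  proof -
    have "Max ((\<lambda>i. h (xs ! i)) ` {..<?n}) \<in> (\<lambda>i. h (xs ! i)) ` {..<?n}"
      using len by (intro Max_in) (auto simp: lessThan_empty_iff)
    then obtain i where "i < ?n" "Max ((\<lambda>i. h (xs ! i)) ` {..<?n}) = h (xs ! i)" by auto
    then show ?thesis by (metis Max_ge finite_imageI finite_lessThan imageI lessThan_iff)
  qed
  then obtain i where i: "i < ?n" and top: "\<And>j. j < ?n \<Longrightarrow> h (xs ! j) \<le> h (xs ! i)" by blast
  have par: "b = p a" if "{a, b} \<in> parent_edges N r p" "h b \<le> h a" for a b
    using that assms unfolding rooted_tree_def parent_edges_iff by (meson not_le)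
  have ne: "xs \<noteq> []" using len by auto
  have close': "{xs ! (?n - 1), xs ! 0} \<in> parent_edges N r p"
    using close by (simp add: hd_conv_nth[OF ne] last_conv_nth[OF ne])
  \<comment> \<open>The positions after and before \<open>i\<close> on the cycle. They differ
    because the length is at least 3, yet both entries have to be the parent of the highest
    entry.\<close>
  let ?s = "if Suc i < ?n then Suc i else 0" and ?q = "if i = 0 then ?n - 1 else i - 1"
  have s: "?s < ?n" "{xs ! i, xs ! ?s} \<in> parent_edges N r p"
  proof -
    show "?s < ?n" using len by auto
    show "{xs ! i, xs ! ?s} \<in> parent_edges N r p"
    proof (cases "Suc i < ?n")
      case False
      then have "i = ?n - 1" using i by auto
      then show ?thesis using close' False by simp
    qed (use step in auto)
  qed
  have q: "?q < ?n" "{xs ! i, xs ! ?q} \<in> parent_edges N r p"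
  proof -
    show "?q < ?n" using len i by auto
    show "{xs ! i, xs ! ?q} \<in> parent_edges N r p"
      using close' step[of "i - 1"] i by (auto simp: insert_commute)
  qed
  have "xs ! ?s = xs ! ?q"
    using par[OF s(2) top[OF s(1)]] par[OF q(2) top[OF q(1)]] by simp
  then have "?s = ?q"
    using dist s(1) q(1) nth_eq_iff_index_eq by blast
  then show False using len i by (auto split: if_splits)
qed

lemma tree_parent_edges:
  "rooted_tree N r p h \<Longrightarrow> tree N (parent_edges N r p)"
  unfolding tree_def
  using graph_parent_edges connected_parent_edges acyclic_parent_edges
  by (metis empty_iff rooted_tree_def)

section \<open>Every tree arises from a parent function\<close>

lemma rtranclp_distinct_path:
  assumes "R\<^sup>*\<^sup>* u v"
  shows "\<exists>xs. xs \<noteq> [] \<and> hd xs = u \<and> last xs = v \<and> distinct xs \<and>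
    (\<forall>i. Suc i < length xs \<longrightarrow> R (xs ! i) (xs ! Suc i))"
  using assms
proof (induction rule: rtranclp_induct)
  case base
  show ?case by (intro exI[of _ "[u]"]) auto
next
  case (step v w)
  then obtain xs where xs: "xs \<noteq> []" "hd xs = u" "last xs = v" "distinct xs"
    "\<And>i. Suc i < length xs \<Longrightarrow> R (xs ! i) (xs ! Suc i)" by blast
  show ?case
  \<comment> \<open>When the walk returns to a vertex of the path, the path is cut back to that
    vertex; otherwise it is extended.\<close>
  proof (cases "w \<in> set xs")
    case True
    then obtain n where n: "n < length xs" "xs ! n = w" by (auto simp: in_set_conv_nth)
    have "last (take (Suc n) xs) = w"
      using n by (simp add: take_Suc_conv_app_nth)
    then show ?thesis using n xs
      by (intro exI[of _ "take (Suc n) xs"]) auto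
  next
    case False
    have "R ((xs @ [w]) ! i) ((xs @ [w]) ! Suc i)" if "Suc i < length (xs @ [w])" for i
    proof (cases "Suc i < length xs")
      case True
      then show ?thesis using xs(5) by (simp add: nth_append)
    next
      case False
      then have "i = length xs - 1" "Suc i = length xs" using that by auto
      then show ?thesis using xs step.hyps(2) by (simp add: nth_append last_conv_nth)
    qed
    then show ?thesis using xs False
      by (intro exI[of _ "xs @ [w]"]) auto
  qed
qed

text \<open>If no edge inside \<open>C\<close> left \<open>A\<close>, then induction along a path
  from \<open>u\<close> to \<open>v\<close> would never leave \<open>A\<close>. This serves both to
  grow a subtree and to follow the connected set of nodes whose bags contain a given vertex.\<close>

lemma connected_on_boundary_edge:
  assumes "connected_on F C" "u \<in> C" "v \<in> C" "u \<in> A" "v \<notin> A"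
  shows "\<exists>x y. x \<in> C \<and> y \<in> C \<and> {x, y} \<in> F \<and> x \<in> A \<and> y \<notin> A"
proof (rule ccontr)
  assume none: "\<not> ?thesis"
  have "(\<lambda>x y. x \<in> C \<and> y \<in> C \<and> {x, y} \<in> F)\<^sup>*\<^sup>* u v"
    using assms unfolding connected_on_def by blast
  then have "v \<in> A"
    by (induction rule: rtranclp_induct) (use assms none in blast)+
  then show False using assms by blast
qed

text \<open>Grow a largest rooted subtree that spans an induced subgraph; a vertex outside it
  with two neighbours inside would close a cycle.\<close>

lemma tree_imp_rooted_tree:
  assumes T: "tree N F" and r: "r \<in> N"
  obtains p h where "rooted_tree N r p h" "F = parent_edges N r p"
proof -
  have fin: "finite N" and gr: "graph N F" and conn: "connected_on F N" and nocyc: "\<not> has_cycle N F"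
    using T unfolding tree_def graph_def by auto
  define good where "good M \<longleftrightarrow> M \<subseteq> N \<and>
    (\<exists>p h. rooted_tree M r p h \<and> {e \<in> F. e \<subseteq> M} = parent_edges M r p)" for M
  have "good {r}"
  proof -
    have "\<not> e \<subseteq> {r}" if "e \<in> F" for e
      using gr that unfolding graph_def by auto
    then show ?thesis
      using r unfolding good_def rooted_tree_def parent_edges_def by auto
  qed
  moreover have "card M \<le> card N" if "good M" for M
    using fin that unfolding good_def by (blast intro: card_mono)
  ultimately obtain M where M: "good M" and M_max: "\<And>M'. good M' \<Longrightarrow> card M' \<le> card M"
    using obtain_greatest_nat[of good "{r}" card "card N"] by blast
  from M obtain p h where MN: "M \<subseteq> N" and rt: "rooted_tree M r p h"
    and FM: "{e \<in> F. e \<subseteq> M} = parent_edges M r p"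
    unfolding good_def by blast
  have finM: "finite M" and rM: "r \<in> M" using rt unfolding rooted_tree_def by auto
  have "M = N"
  proof (rule ccontr)
    assume "M \<noteq> N"
    then obtain v where "v \<in> N" "v \<notin> M" using MN by blast
    then obtain y x where xy: "x \<in> N" "x \<notin> M" "y \<in> M" "{y, x} \<in> F"
      using connected_on_boundary_edge[OF conn r, of v M] rM by blast
    have uniq: "y' = y" if y': "y' \<in> M" "{y', x} \<in> F" for y'
    proof (rule ccontr)
      assume "y' \<noteq> y"
      let ?R = "\<lambda>a b. a \<in> M \<and> b \<in> M \<and> {a, b} \<in> parent_edges M r p"
      have "?R\<^sup>*\<^sup>* y y'"
        using connected_parent_edges[OF rt] xy(3) y'(1) unfolding connected_on_def by blast
      then obtain ys where ys: "ys \<noteq> []" "hd ys = y" "last ys = y'" "distinct ys"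
        "\<And>i. Suc i < length ys \<Longrightarrow> ?R (ys ! i) (ys ! Suc i)"
        using rtranclp_distinct_path[of ?R y y'] by blast
      have len: "length ys \<ge> 2"
        using ys(1-3) \<open>y' \<noteq> y\<close> by (cases ys; cases "tl ys") auto
      have "ys ! i \<in> M" if "i < length ys" for i
      proof (cases i)
        case 0
        then show ?thesis using ys(1,2) xy(3) by (simp add: hd_conv_nth[symmetric])
      next
        case (Suc j)
        then show ?thesis using ys(5)[of j] that by simp
      qed
      then have set_ys: "set ys \<subseteq> M" by (auto simp: in_set_conv_nth)
      have sub: "parent_edges M r p \<subseteq> F" using FM by auto
      have "has_cycle N F"
        unfolding has_cycle_def
      proof (intro exI[of _ "ys @ [x]"] conjI allI impI)
        show "3 \<le> length (ys @ [x])" using len by simp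
        show "distinct (ys @ [x])" using ys(4) set_ys xy(2) by auto
        show "set (ys @ [x]) \<subseteq> N" using set_ys MN xy(1) by auto
        show "{last (ys @ [x]), hd (ys @ [x])} \<in> F"
          using ys xy(4) by (simp add: insert_commute)
        show "{(ys @ [x]) ! i, (ys @ [x]) ! Suc i} \<in> F" if "Suc i < length (ys @ [x])" for i
        proof (cases "Suc i < length ys")
          case True
          then show ?thesis using ys(5) sub by (auto simp: nth_append)
        next
          case False
          then have "i = length ys - 1" "Suc i = length ys" using that by auto
          then show ?thesis using ys(1,3) y'(2) by (simp add: nth_append last_conv_nth)
        qed
      qed
      then show False using nocyc by blast
    qed
    let ?M = "insert x M" and ?p = "p(x := y)" and ?h = "h(x := Suc (h y))"
    have px: "p z \<in> M" "h (p z) < h z" if "z \<in> M - {r}" for z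
      using rt that unfolding rooted_tree_def by auto
    have "rooted_tree ?M r ?p ?h"
      unfolding rooted_tree_def using finM rM xy px by auto
    moreover have "{e \<in> F. e \<subseteq> ?M} = parent_edges ?M r ?p"
    proof -
      have "{e \<in> F. e \<subseteq> ?M} = insert {x, y} {e \<in> F. e \<subseteq> M}"
      proof (intro equalityI subsetI)
        fix e assume e: "e \<in> {e \<in> F. e \<subseteq> ?M}"
        show "e \<in> insert {x, y} {e \<in> F. e \<subseteq> M}"
        proof (cases "x \<in> e")
          case True
          have "e \<in> F" using e by simp
          then obtain a b where "e = {a, b}" "a \<noteq> b" using gr unfolding graph_def by metis
          then obtain c where c: "e = {c, x}" "c \<noteq> x" using True by blast
          then have "c = y" using e by (intro uniq) auto
          then show ?thesis using c by (simp add: insert_commute)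
        qed (use e in blast)
      next
        fix e assume "e \<in> insert {x, y} {e \<in> F. e \<subseteq> M}"
        then show "e \<in> {e \<in> F. e \<subseteq> ?M}" using xy by (auto simp: insert_commute)
      qed
      also have "\<dots> = parent_edges ?M r ?p"
      proof -
        have "?M - {r} = insert x (M - {r})" using xy rM by auto
        moreover have "(\<lambda>z. {z, ?p z}) ` (M - {r}) = (\<lambda>z. {z, p z}) ` (M - {r})"
          using xy by (intro image_cong) auto
        ultimately show ?thesis unfolding FM parent_edges_def by simp
      qed
      finally show ?thesis .
    qed
    ultimately have "good ?M" using MN xy(1) unfolding good_def by blast
    then show False using M_max[of ?M] finM xy(2) by simp
  qed
  moreover have "{e \<in> F. e \<subseteq> N} = F" using gr unfolding graph_def by auto
  ultimately show thesis using that rt FM by simp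
qed

section \<open>Balanced separations from tree decompositions\<close>

text \<open>The pieces are what hangs below the children of a deepest node whose subtree covers
  at least half of \<open>S\<close>, together with what lies outside that subtree.\<close>

lemma tree_decomposition_balanced_bag:
  assumes td: "tree_decomposition V E VT ET B" and wd: "\<forall>x\<in>VT. card (B x) \<le> k"
    and finV: "finite V" and SV: "S \<subseteq> V"
  obtains X Q where "X \<subseteq> V" "card X \<le> k" "finite Q" "\<Union>Q = V - X" "disjoint Q"
    "\<And>C. C \<in> Q \<Longrightarrow> 2 * card (S \<inter> C) \<le> card S"
    "\<And>C u v. C \<in> Q \<Longrightarrow> {u, v} \<in> E \<Longrightarrow> u \<in> C \<Longrightarrow> v \<notin> X \<Longrightarrow> v \<in> C"
proof -
  have T: "tree VT ET" and BV: "\<And>x. x \<in> VT \<Longrightarrow> B x \<subseteq> V"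
    and cov: "\<And>v. v \<in> V \<Longrightarrow> \<exists>x\<in>VT. v \<in> B x"
    and edge: "\<And>e. e \<in> E \<Longrightarrow> \<exists>x\<in>VT. e \<subseteq> B x"
    and conn: "\<And>v. v \<in> V \<Longrightarrow> connected_on ET {x \<in> VT. v \<in> B x}"
    using td unfolding tree_decomposition_def by auto
  obtain r where r: "r \<in> VT" using T unfolding tree_def by auto
  obtain p h where rt: "rooted_tree VT r p h" and ET: "ET = parent_edges VT r p"
    using tree_imp_rooted_tree[OF T r] .
  have finT: "finite VT" and px: "\<And>x. x \<in> VT \<Longrightarrow> x \<noteq> r \<Longrightarrow> p x \<in> VT \<and> h (p x) < h x"
    using rt unfolding rooted_tree_def by auto
  \<comment> \<open>Child-to-parent steps, the subtree below a node, and the part of the graph that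
    the bags of this subtree cover.\<close>
  define R where "R = {(x, p x) |x. x \<in> VT - {r}}"
  define D where "D x = {w \<in> VT. (w, x) \<in> R\<^sup>*}" for x
  define U where "U x = (\<Union>w\<in>D x. B w)" for x
  have h_mono: "h x \<le> h w" if "(w, x) \<in> R\<^sup>*" for w x
    using that by (induction rule: rtrancl_induct) (use px in \<open>force simp: R_def\<close>)+
  have sv: "single_valued R" unfolding R_def single_valued_def by auto
  have D_root: "w \<in> D r" if "w \<in> VT" for w
    using that
  proof (induction "h w" arbitrary: w rule: less_induct)
    case less
    show ?case
    proof (cases "w = r")
      case False
      then have "p w \<in> D r" using less px by auto
      moreover have "(w, p w) \<in> R" using False less.prems by (auto simp: R_def)
      ultimately show ?thesis using less.prems unfolding D_def
        by (auto intro: converse_rtrancl_into_rtrancl)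
    qed (use r in \<open>auto simp: D_def\<close>)
  qed
  \<comment> \<open>A tree edge runs to a child or to the parent. Steps to children stay below
    \<open>y\<close>, and so do parent steps from proper descendants of \<open>y\<close>; only the
    parent step from \<open>y\<close> itself is left.\<close>
  have leave: "x = y \<and> w = p y"
    if "{x, w} \<in> ET" "x \<in> D y" "w \<in> VT" "w \<notin> D y" for x w y
  proof -
    have "(x \<in> VT - {r} \<and> w = p x) \<or> (w \<in> VT - {r} \<and> x = p w)"
      using that(1) unfolding ET parent_edges_iff .
    then consider "x \<in> VT - {r}" "w = p x" | "w \<in> VT - {r}" "x = p w" by blast
    then show ?thesis
    proof cases
      case 1
      have "(x, y) \<in> R\<^sup>*" using that(2) by (simp add: D_def)
      then show ?thesis
      proof (cases rule: converse_rtranclE)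
        case (step z)
        then have "w \<in> D y" using 1 that(3) by (auto simp: R_def D_def)
        then show ?thesis using that(4) by simp
      qed (use 1 in simp)
    next
      case 2
      then have "(w, x) \<in> R" by (auto simp: R_def)
      then have "w \<in> D y" using that(2,3)
        by (auto simp: D_def intro: converse_rtrancl_into_rtrancl)
      then show ?thesis using that(4) by simp
    qed
  qed
  \<comment> \<open>The nodes whose bags contain \<open>v\<close> are connected. To leave the
    subtree below \<open>y\<close> they would have to pass through \<open>p y\<close>, whose bag
    misses \<open>v\<close>.\<close>
  have inside: "{x \<in> VT. v \<in> B x} \<subseteq> D y" if vU: "v \<in> U y" and vp: "v \<notin> B (p y)" for v y
  proof
    fix z assume z: "z \<in> {x \<in> VT. v \<in> B x}"
    then have "v \<in> V" using BV by blast
    obtain w where w: "w \<in> D y" "v \<in> B w" using vU by (auto simp: U_def)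
    show "z \<in> D y"
    proof (rule ccontr)
      assume "z \<notin> D y"
      then obtain a b where "b \<in> VT" "v \<in> B b" "{a, b} \<in> ET" "a \<in> D y" "b \<notin> D y"
        using connected_on_boundary_edge[OF conn[OF \<open>v \<in> V\<close>], of w z "D y"] z w
        by (auto simp: D_def)
      then show False using leave vp by blast
    qed
  qed
  have U_root: "U r = V"
  proof -
    have "D r = VT" using D_root by (auto simp: D_def)
    then show ?thesis using cov BV unfolding U_def by auto
  qed
  define big where "big x \<longleftrightarrow> x \<in> VT \<and> card S \<le> 2 * card (S \<inter> U x)" for x
  have "big r" using r U_root SV by (simp add: big_def Int_absorb2)
  moreover have "h x \<le> Max (h ` VT)" if "big x" for x using finT that by (simp add: big_def)
  ultimately obtain x where x: "big x" and x_max: "\<And>y. big y \<Longrightarrow> h y \<le> h x"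
    using obtain_greatest_nat[of big r h "Max (h ` VT)"] by blast
  define K where "K = {y \<in> VT - {r}. p y = x}"
  \<comment> \<open>Only the children's pieces need \<open>B x\<close> removed; the outer piece
    avoids it already, since \<open>B x\<close> is contained in \<open>U x\<close>.\<close>
  define Q where "Q = insert (V - U x) ((\<lambda>y. U y - B x) ` K)"
  have xT: "x \<in> VT" using x by (simp add: big_def)
  have K_D: "D y \<subseteq> D x" if "y \<in> K" for y
  proof -
    have "(y, x) \<in> R" using that by (auto simp: K_def R_def)
    then show ?thesis by (auto simp: D_def)
  qed
  have K_h: "h x < h y" if "y \<in> K" for y using that px by (auto simp: K_def)
  \<comment> \<open>Parents are unique, so two nodes above \<open>w\<close> are comparable. Distinct
    children of \<open>x\<close> are not: a parent step from one leads to \<open>x\<close>, which is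
    lower than the other.\<close>
  have K_disj: "y = y'" if "y \<in> K" "y' \<in> K" "w \<in> D y" "w \<in> D y'" for y y' w
  proof -
    have *: "y = y'" if "(y, y') \<in> R\<^sup>*" "y \<in> K" "y' \<in> K" for y y'
      using that(1)
    proof (cases rule: converse_rtranclE)
      case (step z)
      then have "(x, y') \<in> R\<^sup>*" using that(2) by (auto simp: R_def K_def)
      then show ?thesis using h_mono K_h[OF that(3)] by fastforce
    qed
    show ?thesis
      using single_valued_confluent[OF sv, of w y y'] * that by (auto simp: D_def)
  qed
  have K_inside: "{w \<in> VT. v \<in> B w} \<subseteq> D y" if "y \<in> K" "v \<in> U y - B x" for y v
    using inside[of v y] that by (auto simp: K_def)
  show thesis
  proof (rule that[of "B x" Q])
    show "B x \<subseteq> V" "card (B x) \<le> k" using BV wd xT by auto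
    show "finite Q" using finT by (auto simp: Q_def K_def)
    show "\<Union>Q = V - B x"
    proof (intro equalityI subsetI)
      fix v assume "v \<in> \<Union>Q"
      moreover have "B x \<subseteq> U x" using xT by (auto simp: U_def D_def)
      moreover have "U y \<subseteq> V" for y using BV by (auto simp: U_def D_def)
      ultimately show "v \<in> V - B x" by (auto simp: Q_def)
    next
      fix v assume v: "v \<in> V - B x"
      show "v \<in> \<Union>Q"
      proof (cases "v \<in> U x")
        case True
        then obtain w where w: "w \<in> VT" "(w, x) \<in> R\<^sup>*" "v \<in> B w" by (auto simp: U_def D_def)
        moreover have "w \<noteq> x" using w v by auto
        ultimately obtain y where "(w, y) \<in> R\<^sup>*" "(y, x) \<in> R" by (metis rtranclE)
        then have "y \<in> K" "w \<in> D y" using w by (auto simp: R_def K_def D_def)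
        then show ?thesis using w v by (auto simp: Q_def U_def)
      qed (use v in \<open>auto simp: Q_def\<close>)
    qed
    show "disjoint Q"
    proof -
      have 1: "(V - U x) \<inter> (U y - B x) = {}" if "y \<in> K" for y
        using K_D[OF that] by (auto simp: U_def)
      have 2: "(U y - B x) \<inter> (U y' - B x) = {}" if "y \<in> K" "y' \<in> K" "y \<noteq> y'" for y y'
      proof (rule ccontr)
        assume "\<not> ?thesis"
        then obtain v where v: "v \<in> U y - B x" "v \<in> U y' - B x" by auto
        then obtain w where "w \<in> D y'" "w \<in> VT" "v \<in> B w" by (auto simp: U_def D_def)
        then have "w \<in> D y" using K_inside[OF that(1) v(1)] by auto
        then show False using K_disj that \<open>w \<in> D y'\<close> by blast
      qed
      show ?thesis
        unfolding disjoint_def Q_def using 1 2 by (auto 0 0; blast)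
    qed
    show "2 * card (S \<inter> C) \<le> card S" if CQ: "C \<in> Q" for C
    proof (cases "C = V - U x")
      case True
      have "card (S \<inter> U x) + card (S \<inter> C) = card S"
      proof -
        have "S = (S \<inter> U x) \<union> (S \<inter> C)" using True SV by auto
        moreover have "card ((S \<inter> U x) \<union> (S \<inter> C)) = card (S \<inter> U x) + card (S \<inter> C)"
          using True finite_subset[OF SV finV] by (intro card_Un_disjoint) auto
        ultimately show ?thesis by simp
      qed
      then show ?thesis using x by (simp add: big_def)
    next
      case False
      then obtain y where y: "y \<in> K" "C = U y - B x" using CQ by (auto simp: Q_def)
      then have "\<not> big y" using K_h x_max by fastforce
      then have "2 * card (S \<inter> U y) \<le> card S" using y by (simp add: big_def K_def)
      moreover have "card (S \<inter> C) \<le> card (S \<inter> U y)"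
        using y finite_subset[OF SV finV] by (intro card_mono) auto
      ultimately show ?thesis by simp
    qed
    show "v \<in> C" if CQ: "C \<in> Q" and uv: "{u, v} \<in> E" and uC: "u \<in> C" and vx: "v \<notin> B x" for C u v
    proof -
      obtain w where w: "w \<in> VT" "u \<in> B w" "v \<in> B w" using edge[OF uv] by auto
      have "v \<in> V" using w BV by auto
      \<comment> \<open>The bag of \<open>w\<close> holds both ends of the edge. If one end lies in
        a child's piece, then \<open>w\<close> lies in that child's subtree, which therefore covers
        the other end too. For the outer piece this is applied from \<open>v\<close> back to
        \<open>u\<close>.\<close>
      have same: "b \<in> U y" if "y \<in> K" "a \<in> U y - B x" "a \<in> B w" "b \<in> B w" for y a b
        using K_inside[OF that(1,2)] w that unfolding U_def by blast
      show ?thesis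
      proof (cases "C = V - U x")
        case True
        have "v \<notin> U x"
        proof
          assume "v \<in> U x"
          then obtain z where "z \<in> VT" "(z, x) \<in> R\<^sup>*" "v \<in> B z" by (auto simp: U_def D_def)
          moreover from this have "z \<noteq> x" using vx by auto
          ultimately obtain y where "(z, y) \<in> R\<^sup>*" "(y, x) \<in> R" by (metis rtranclE)
          then have y: "y \<in> K" "v \<in> U y"
            using \<open>z \<in> VT\<close> \<open>v \<in> B z\<close> by (auto simp: R_def K_def D_def U_def)
          then have "u \<in> U y" using same[of y v u] vx w by auto
          then show False using K_D[OF y(1)] uC True by (auto simp: U_def)
        qed
        then show ?thesis using True \<open>v \<in> V\<close> by simp
      next
        case False
        then obtain y where "y \<in> K" "C = U y - B x" using CQ by (auto simp: Q_def)
        then show ?thesis using same[of y u v] uC vx w by auto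
      qed
    qed
  qed
qed

lemma disjoint_Union_Diff:
  assumes "disjoint Q" "J \<subseteq> Q"
  shows "\<Union>J \<inter> \<Union>(Q - J) = {}"
proof -
  have "A \<inter> B = {}" if "A \<in> J" "B \<in> Q - J" for A B
    using disjointD[OF assms(1), of A B] that assms(2) by blast
  then show ?thesis by blast
qed

text \<open>A piece with at least a third of \<open>S\<close> can form one side alone: it has at
  most half, which leaves at most two thirds. If all pieces are smaller, take as many as possible
  without exceeding two thirds. One further piece would exceed that bound while adding less than a
  third, so the chosen pieces hold more than a third and the others less than two thirds.\<close>

lemma balanced_grouping:
  assumes finS: "finite S" and finQ: "finite Q" and disj: "disjoint Q"
    and half: "\<And>C. C \<in> Q \<Longrightarrow> 2 * card (S \<inter> C) \<le> card S"
  obtains J where "J \<subseteq> Q" "3 * card (S \<inter> \<Union>J) \<le> 2 * card S"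
    "3 * card (S \<inter> \<Union>(Q - J)) \<le> 2 * card S"
proof -
  have compl: "card (S \<inter> \<Union>J) + card (S \<inter> \<Union>(Q - J)) \<le> card S" if "J \<subseteq> Q" for J
  proof -
    have "\<Union>J \<inter> \<Union>(Q - J) = {}" using disjoint_Union_Diff[OF disj that] .
    then have "card ((S \<inter> \<Union>J) \<union> (S \<inter> \<Union>(Q - J))) = card (S \<inter> \<Union>J) + card (S \<inter> \<Union>(Q - J))"
      using finS by (intro card_Un_disjoint) auto
    moreover have "card ((S \<inter> \<Union>J) \<union> (S \<inter> \<Union>(Q - J))) \<le> card S"
      using finS by (intro card_mono) auto
    ultimately show ?thesis by simp
  qed
  show thesis
  proof (cases "\<exists>C\<in>Q. card S \<le> 3 * card (S \<inter> C)")
    case True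
    then obtain C where "C \<in> Q" "card S \<le> 3 * card (S \<inter> C)" by blast
    then show ?thesis using half[of C] compl[of "{C}"] by (intro that[of "{C}"]) auto
  next
    case False
    define ok where "ok J \<longleftrightarrow> J \<subseteq> Q \<and> 3 * card (S \<inter> \<Union>J) \<le> 2 * card S" for J
    have "ok {}" by (simp add: ok_def)
    moreover have "card J \<le> card Q" if "ok J" for J using finQ that by (auto simp: ok_def intro: card_mono)
    ultimately obtain J where J: "ok J" and J_max: "\<And>J'. ok J' \<Longrightarrow> card J' \<le> card J"
      using obtain_greatest_nat[of ok "{}" card "card Q"] by blast
    show ?thesis
    proof (cases "J = Q")
      case True
      then show ?thesis using J by (intro that[of J]) (auto simp: ok_def)
    next
      case False
      then obtain C where C: "C \<in> Q" "C \<notin> J" using J by (auto simp: ok_def)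
      have "finite J" using J finQ finite_subset by (auto simp: ok_def)
      then have "\<not> ok (insert C J)" using J_max[of "insert C J"] C by auto
      then have "2 * card S < 3 * card (S \<inter> \<Union>(insert C J))"
        using J C by (auto simp: ok_def)
      moreover have "card (S \<inter> \<Union>(insert C J)) \<le> card (S \<inter> C) + card (S \<inter> \<Union>J)"
        by (metis Int_Un_distrib Union_insert card_Un_le)
      moreover have "3 * card (S \<inter> C) < card S"
        using \<open>\<not> (\<exists>C\<in>Q. card S \<le> 3 * card (S \<inter> C))\<close> C by auto
      ultimately show ?thesis
        using compl[of J] J by (intro that[of J]) (auto simp: ok_def)
    qed
  qed
qed

text \<open>Both sides consist of the balanced bag \<open>X\<close> and one of the two groups of
  pieces, so they meet exactly in \<open>X\<close>. An edge between the strict sides would leave a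
  piece without entering \<open>X\<close>.\<close>

lemma tree_decomposition_separation:
  assumes "tree_decomposition V E VT ET B" "\<forall>x\<in>VT. card (B x) \<le> k"
    and finV: "finite V" and SV: "S \<subseteq> V"
  obtains A A' where "A \<union> A' = V" "card (A \<inter> A') \<le> k"
    "3 * card (S - A) \<le> 2 * card S" "3 * card (S - A') \<le> 2 * card S"
    "\<And>u v. {u, v} \<in> E \<Longrightarrow> u \<in> A - A' \<Longrightarrow> v \<notin> A' - A"
proof -
  obtain X Q where X: "X \<subseteq> V" "card X \<le> k" and Q: "finite Q" "\<Union>Q = V - X" "disjoint Q"
    and half: "\<And>C. C \<in> Q \<Longrightarrow> 2 * card (S \<inter> C) \<le> card S"
    and closed: "\<And>C u v. C \<in> Q \<Longrightarrow> {u, v} \<in> E \<Longrightarrow> u \<in> C \<Longrightarrow> v \<notin> X \<Longrightarrow> v \<in> C"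
    using tree_decomposition_balanced_bag[OF assms] by blast
  obtain J where J: "J \<subseteq> Q" "3 * card (S \<inter> \<Union>J) \<le> 2 * card S"
    "3 * card (S \<inter> \<Union>(Q - J)) \<le> 2 * card S"
    using balanced_grouping[of S Q] finite_subset[OF SV finV] Q(1,3) half by blast
  have disj: "\<Union>J \<inter> \<Union>(Q - J) = {}" using disjoint_Union_Diff[OF Q(3) J(1)] .
  have un: "\<Union>J \<union> \<Union>(Q - J) = V - X" using Q(2) J(1) by blast
  show thesis
  proof (rule that[of "X \<union> \<Union>J" "X \<union> \<Union>(Q - J)"])
    show "X \<union> \<Union>J \<union> (X \<union> \<Union>(Q - J)) = V" using un X(1) by blast
    have "(X \<union> \<Union>J) \<inter> (X \<union> \<Union>(Q - J)) = X" using disj by blast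
    then show "card ((X \<union> \<Union>J) \<inter> (X \<union> \<Union>(Q - J))) \<le> k" using X(2) by simp
    have "S - (X \<union> \<Union>J) = S \<inter> \<Union>(Q - J)" "S - (X \<union> \<Union>(Q - J)) = S \<inter> \<Union>J"
      using un disj SV by blast+
    then show "3 * card (S - (X \<union> \<Union>J)) \<le> 2 * card S"
      "3 * card (S - (X \<union> \<Union>(Q - J))) \<le> 2 * card S" using J by simp_all
    show "v \<notin> X \<union> \<Union>(Q - J) - (X \<union> \<Union>J)"
      if "{u, v} \<in> E" "u \<in> X \<union> \<Union>J - (X \<union> \<Union>(Q - J))" for u v
      using that closed J(1) by blast
  qed
qed

section \<open>Rooted tree-partitions\<close>

definition children :: "'b set \<Rightarrow> 'b \<Rightarrow> ('b \<Rightarrow> 'b) \<Rightarrow> 'b \<Rightarrow> 'b set" where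
  "children N r p x = {y \<in> N - {r}. p y = x}"

text \<open>An edge at \<open>x\<close> leads to a child or is the parent edge of \<open>x\<close>.
  The extra 1 for non-roots is why their number of children is later bounded strictly.\<close>

lemma degree_parent_edges:
  assumes "finite N"
  shows "degree (parent_edges N r p) x \<le> card (children N r p x) + (if x = r then 0 else 1)"
proof -
  let ?up = "if x = r then {} else {{x, p x}}"
  have fin: "finite (children N r p x)" using assms by (simp add: children_def)
  have "{e \<in> parent_edges N r p. x \<in> e} \<subseteq> (\<lambda>y. {y, p y}) ` children N r p x \<union> ?up"
    unfolding parent_edges_def children_def by auto
  then have "degree (parent_edges N r p) x \<le> card ((\<lambda>y. {y, p y}) ` children N r p x \<union> ?up)"
    unfolding degree_def using fin by (intro card_mono) auto
  also have "\<dots> \<le> card ((\<lambda>y. {y, p y}) ` children N r p x) + card ?up"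
    by (rule card_Un_le)
  also have "\<dots> \<le> card (children N r p x) + (if x = r then 0 else 1)"
    using card_image_le[OF fin, of "\<lambda>y. {y, p y}"] by (cases "x = r") simp_all
  finally show ?thesis .
qed

text \<open>The nodes of the tree are the bags themselves, so bags have to be nonempty, but no
  node ever has to be renamed when partitions of disjoint vertex sets are combined.\<close>

definition rooted_partition :: "'a set set \<Rightarrow> 'a set \<Rightarrow> 'a set set \<Rightarrow> 'a set
    \<Rightarrow> ('a set \<Rightarrow> 'a set) \<Rightarrow> ('a set \<Rightarrow> nat) \<Rightarrow> bool" where
  "rooted_partition E U N Z p h \<longleftrightarrow> rooted_tree N Z p h \<and> \<Union>N = U \<and> disjoint N \<and> {} \<notin> N \<and>
    (\<forall>A\<in>N. \<forall>B\<in>N. \<forall>u\<in>A. \<forall>v\<in>B. {u, v} \<in> E \<longrightarrow> A = B \<or> {A, B} \<in> parent_edges N Z p)"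

lemma rooted_partition_root_subset:
  "rooted_partition E U N Z p h \<Longrightarrow> Z \<subseteq> U"
  unfolding rooted_partition_def rooted_tree_def by blast

lemma rooted_partition_edge:
  assumes "rooted_partition E U N Z p h" "A \<in> N" "B \<in> N" "u \<in> A" "v \<in> B" "{u, v} \<in> E"
  shows "A = B \<or> (A \<noteq> Z \<and> B = p A) \<or> (B \<noteq> Z \<and> A = p B)"
  using assms unfolding rooted_partition_def parent_edges_iff by blast

lemma rooted_partitionI:
  assumes "rooted_tree N Z p h" "\<Union>N = U" "disjoint N" "{} \<notin> N"
    and "\<And>A B u v. A \<in> N \<Longrightarrow> B \<in> N \<Longrightarrow> u \<in> A \<Longrightarrow> v \<in> B \<Longrightarrow> {u, v} \<in> E \<Longrightarrow>
      A = B \<or> (A \<noteq> Z \<and> B = p A) \<or> (B \<noteq> Z \<and> A = p B)"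
  shows "rooted_partition E U N Z p h"
  unfolding rooted_partition_def parent_edges_iff using assms by blast

lemma rooted_partition_single:
  "U \<noteq> {} \<Longrightarrow> rooted_partition E U {U} U p h"
  by (auto simp: rooted_partition_def rooted_tree_def)

text \<open>Since the neighbours of \<open>S\<close> in \<open>U\<close> all lie in
  \<open>Z\<close>, edges out of \<open>S\<close> reach no bag but \<open>Z\<close>. Redefining
  \<open>p\<close> at \<open>Z\<close> alters only the old root, which was nobody's child, so all
  old bags keep their children.\<close>

lemma rooted_partition_add_root:
  assumes rp: "rooted_partition E U N Z p h" and S: "S \<noteq> {}" "S \<inter> U = {}"
    and nb: "\<forall>u\<in>S. \<forall>v\<in>U. {u, v} \<in> E \<longrightarrow> v \<in> Z"
  shows "rooted_partition E (S \<union> U) (insert S N) S (p(Z := S)) (\<lambda>A. if A = S then 0 else Suc (h A))"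
    and "children (insert S N) S (p(Z := S)) S = {Z}"
    and "C \<in> N \<Longrightarrow> children (insert S N) S (p(Z := S)) C = children N Z p C"
proof -
  have rt: "rooted_tree N Z p h" and U: "\<Union>N = U" and disj: "disjoint N" and ne: "{} \<notin> N"
    using rp unfolding rooted_partition_def by auto
  have Z: "Z \<in> N" and px: "\<And>A. A \<in> N \<Longrightarrow> A \<noteq> Z \<Longrightarrow> p A \<in> N \<and> h (p A) < h A" and fin: "finite N"
    using rt unfolding rooted_tree_def by auto
  have SA: "S \<inter> A = {}" if "A \<in> N" for A using S U that by auto
  have SN: "S \<notin> N" using SA S by blast
  show "rooted_partition E (S \<union> U) (insert S N) S (p(Z := S)) (\<lambda>A. if A = S then 0 else Suc (h A))"
  proof (rule rooted_partitionI)
    show "rooted_tree (insert S N) S (p(Z := S)) (\<lambda>A. if A = S then 0 else Suc (h A))"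
      unfolding rooted_tree_def using fin px SN by auto
    show "\<Union>(insert S N) = S \<union> U" using U by auto
    show "disjoint (insert S N)"
      using disj SA unfolding disjoint_def by blast
    show "{} \<notin> insert S N" using ne S by auto
    have root: "B = Z" if "B \<in> N" "u \<in> S" "v \<in> B" "{u, v} \<in> E" for B u v
    proof -
      have "v \<in> Z" using nb that U by blast
      then show ?thesis using disjointD[OF disj that(1) Z] that(3) by blast
    qed
    fix A B u v
    assume AB: "A \<in> insert S N" "B \<in> insert S N" and uv: "u \<in> A" "v \<in> B" "{u, v} \<in> E"
    then have vu: "{v, u} \<in> E" by (simp add: insert_commute)
    consider "A = S" "B = S" | "A = S" "B \<in> N" | "A \<in> N" "B = S" | "A \<in> N" "B \<in> N"
      using AB by blast
    then show "A = B \<or> (A \<noteq> S \<and> B = (p(Z := S)) A) \<or> (B \<noteq> S \<and> A = (p(Z := S)) B)"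
    proof cases
      case 2
      then show ?thesis using root[of B u v] uv SN by auto
    next
      case 3
      then show ?thesis using root[of A v u] uv vu SN by auto
    next
      case 4
      then show ?thesis using rooted_partition_edge[OF rp 4 uv] SN by auto
    qed simp
  qed
  have pS: "p A \<noteq> S" if "A \<in> N" "A \<noteq> Z" for A using px[OF that] SN by auto
  show "children (insert S N) S (p(Z := S)) S = {Z}"
    using pS Z SN unfolding children_def by auto
  show "C \<in> N \<Longrightarrow> children (insert S N) S (p(Z := S)) C = children N Z p C"
    using SN unfolding children_def by auto
qed

text \<open>The two trees are merged at their roots. The vertex sets overlap only within both root
  bags, so a non-root bag of one tree is disjoint from the other vertex set, and by
  \<open>sep\<close> its edges stay in its own tree. The children of the new root are those of the
  two old roots, which makes the counts add up.\<close>

lemma rooted_partition_glue: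
  assumes rp1: "rooted_partition E U1 N1 Z1 p1 h1" and rp2: "rooted_partition E U2 N2 Z2 p2 h2"
    and meet: "U1 \<inter> U2 \<subseteq> Z1 \<inter> Z2"
    and sep: "\<forall>u\<in>U1 - U2. \<forall>v\<in>U2 - U1. {u, v} \<notin> E"
  defines "Z \<equiv> Z1 \<union> Z2"
  defines "N \<equiv> insert Z ((N1 - {Z1}) \<union> (N2 - {Z2}))"
  obtains p h where "rooted_partition E (U1 \<union> U2) N Z p h"
    "children N Z p Z = children N1 Z1 p1 Z1 \<union> children N2 Z2 p2 Z2"
    "\<And>C. C \<in> N1 - {Z1} \<Longrightarrow> children N Z p C = children N1 Z1 p1 C"
    "\<And>C. C \<in> N2 - {Z2} \<Longrightarrow> children N Z p C = children N2 Z2 p2 C"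
proof -
  have rt1: "rooted_tree N1 Z1 p1 h1" and U1: "\<Union>N1 = U1" and disj1: "disjoint N1" and ne1: "{} \<notin> N1"
    using rp1 unfolding rooted_partition_def by auto
  have rt2: "rooted_tree N2 Z2 p2 h2" and U2: "\<Union>N2 = U2" and disj2: "disjoint N2" and ne2: "{} \<notin> N2"
    using rp2 unfolding rooted_partition_def by auto
  have Z1: "Z1 \<in> N1" and px1: "\<And>A. A \<in> N1 \<Longrightarrow> A \<noteq> Z1 \<Longrightarrow> p1 A \<in> N1 \<and> h1 (p1 A) < h1 A" and fin1: "finite N1"
    using rt1 unfolding rooted_tree_def by auto
  have Z2: "Z2 \<in> N2" and px2: "\<And>A. A \<in> N2 \<Longrightarrow> A \<noteq> Z2 \<Longrightarrow> p2 A \<in> N2 \<and> h2 (p2 A) < h2 A" and fin2: "finite N2"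
    using rt2 unfolding rooted_tree_def by auto
  define M1 where "M1 = N1 - {Z1}"
  define M2 where "M2 = N2 - {Z2}"
  have N: "N = insert Z (M1 \<union> M2)" unfolding N_def M1_def M2_def ..
  have M1: "A \<subseteq> U1" "A \<inter> Z1 = {}" "A \<inter> U2 = {}" "A \<noteq> {}" if "A \<in> M1" for A
  proof -
    show "A \<subseteq> U1" "A \<noteq> {}" using that U1 ne1 by (auto simp: M1_def)
    show "A \<inter> Z1 = {}" using that disj1 Z1 unfolding disjoint_def M1_def by blast
    then show "A \<inter> U2 = {}" using \<open>A \<subseteq> U1\<close> meet by blast
  qed
  have M2: "A \<subseteq> U2" "A \<inter> Z2 = {}" "A \<inter> U1 = {}" "A \<noteq> {}" if "A \<in> M2" for A
  proof -
    show "A \<subseteq> U2" "A \<noteq> {}" using that U2 ne2 by (auto simp: M2_def)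
    show "A \<inter> Z2 = {}" using that disj2 Z2 unfolding disjoint_def M2_def by blast
    then show "A \<inter> U1 = {}" using \<open>A \<subseteq> U2\<close> meet by blast
  qed
  have Z1U: "Z1 \<subseteq> U1" and Z2U: "Z2 \<subseteq> U2" using Z1 Z2 U1 U2 by auto
  have MZ: "A \<inter> Z = {}" if "A \<in> M1 \<union> M2" for A
    using that
  proof
    assume "A \<in> M1"
    then show ?thesis using M1(2,3)[of A] Z2U unfolding Z_def by blast
  next
    assume "A \<in> M2"
    then show ?thesis using M2(2,3)[of A] Z1U unfolding Z_def by blast
  qed
  have ZM: "Z \<notin> M1" "Z \<notin> M2" using MZ[of Z] M1(4)[of Z] M2(4)[of Z] by auto
  have "A \<notin> M2" if "A \<in> M1" for A using M1(3,4)[OF that] M2(1)[of A] by blast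
  then have M12: "M1 \<inter> M2 = {}" by blast
  \<comment> \<open>Each non-root bag keeps the parent from its own tree, except that both old roots
    are replaced by \<open>Z\<close>.\<close>
  define p where "p A = (if A \<in> M1 then (if p1 A = Z1 then Z else p1 A)
      else (if p2 A = Z2 then Z else p2 A))" for A
  define h where "h A = (if A = Z then 0 else if A \<in> M1 then Suc (h1 A) else Suc (h2 A))" for A
  have pM1: "p1 A \<in> insert Z1 M1" "h1 (p1 A) < h1 A" if "A \<in> M1" for A
    using that px1 by (auto simp: M1_def)
  have pM2: "p2 A \<in> insert Z2 M2" "h2 (p2 A) < h2 A" if "A \<in> M2" for A
    using that px2 by (auto simp: M2_def)
  have p1_eq: "p A = (if p1 A = Z1 then Z else p1 A)" if "A \<in> M1" for A
    using that by (simp add: p_def)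
  have p2_eq: "p A = (if p2 A = Z2 then Z else p2 A)" if "A \<in> M2" for A
    using that M12 by (auto simp: p_def)
  have rt: "rooted_tree N Z p h"
    unfolding rooted_tree_def
  proof (intro conjI ballI)
    show "finite N" "Z \<in> N" using fin1 fin2 by (auto simp: N_def)
    fix A assume "A \<in> N - {Z}"
    then consider "A \<in> M1" | "A \<in> M2" by (auto simp: N)
    then have "p A \<in> N \<and> h (p A) < h A"
    proof cases
      case 1
      then show ?thesis using pM1[OF 1] ZM unfolding p1_eq[OF 1] by (auto simp: N h_def)
    next
      case 2
      then show ?thesis using pM2[OF 2] ZM M12 unfolding p2_eq[OF 2] by (auto simp: N h_def)
    qed
    then show "p A \<in> N" "h (p A) < h A" by auto
  qed
  have E1: "B = A \<or> B = p A \<or> A = p B" if "A \<in> M1" "B \<in> M1" "u \<in> A" "v \<in> B" "{u, v} \<in> E" for A B u v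
    using rooted_partition_edge[OF rp1 _ _ that(3-5)] that(1,2) p1_eq[OF that(1)] p1_eq[OF that(2)]
    by (auto simp: M1_def)
  have E2: "B = A \<or> B = p A \<or> A = p B" if "A \<in> M2" "B \<in> M2" "u \<in> A" "v \<in> B" "{u, v} \<in> E" for A B u v
    using rooted_partition_edge[OF rp2 _ _ that(3-5)] that(1,2) p2_eq[OF that(1)] p2_eq[OF that(2)]
    by (auto simp: M2_def)
  have E12: False if "A \<in> M1" "B \<in> M2" "u \<in> A" "v \<in> B" "{u, v} \<in> E" for A B u v
    using sep that M1[OF that(1)] M2[OF that(2)] by blast
  \<comment> \<open>As \<open>u\<close> lies outside \<open>U2\<close>, the hypothesis
    \<open>sep\<close> forces \<open>v\<close> into \<open>U1\<close>. Even if \<open>v\<close>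
    comes from \<open>Z2\<close>, it then lies in the overlap, hence in \<open>Z1\<close>.\<close>
  have EZ1: "p A = Z" if "A \<in> M1" "u \<in> A" "v \<in> Z" "{u, v} \<in> E" for A u v
  proof -
    have "u \<in> U1 - U2" using that M1[OF that(1)] by blast
    then have "v \<in> U1" using sep that(3,4) Z1U Z2U unfolding Z_def by blast
    then have "v \<in> Z1" using that(3) meet Z2U unfolding Z_def by blast
    then have "p1 A = Z1"
      using rooted_partition_edge[OF rp1 _ Z1 that(2) _ that(4)] that(1) by (auto simp: M1_def)
    then show ?thesis using p1_eq[OF that(1)] by simp
  qed
  have EZ2: "p A = Z" if "A \<in> M2" "u \<in> A" "v \<in> Z" "{u, v} \<in> E" for A u v
  proof -
    have "u \<in> U2 - U1" using that M2[OF that(1)] by blast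
    moreover have "{v, u} \<in> E" using that(4) by (simp add: insert_commute)
    ultimately have "v \<in> U2" using sep that(3) Z1U Z2U unfolding Z_def by blast
    then have "v \<in> Z2" using that(3) meet Z1U unfolding Z_def by blast
    then have "p2 A = Z2"
      using rooted_partition_edge[OF rp2 _ Z2 that(2) _ that(4)] that(1) by (auto simp: M2_def)
    then show ?thesis using p2_eq[OF that(1)] by simp
  qed
  have rp: "rooted_partition E (U1 \<union> U2) N Z p h"
  proof (rule rooted_partitionI[OF rt])
    show "\<Union>N = U1 \<union> U2"
      using U1 U2 Z1 Z2 by (auto simp: N_def Z_def)
    show "{} \<notin> N" using ne1 ne2 Z1 by (auto simp: N_def Z_def)
    show "disjoint N"
      unfolding disjoint_def
    proof (intro ballI impI)
      fix A B assume AB: "A \<in> N" "B \<in> N" "A \<noteq> B"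
      have 1: "A \<inter> B = {}" if "A \<in> M1" "B \<in> M1" "A \<noteq> B" for A B
        using that disj1 unfolding disjoint_def M1_def by blast
      have 2: "A \<inter> B = {}" if "A \<in> M2" "B \<in> M2" "A \<noteq> B" for A B
        using that disj2 unfolding disjoint_def M2_def by blast
      have 3: "A \<inter> B = {}" if "A \<in> M1" "B \<in> M2" for A B
        using M1(3)[OF that(1)] M2(1)[OF that(2)] by blast
      show "A \<inter> B = {}"
        using AB 1 2 3 MZ unfolding N by (metis Int_commute UnE UnI1 UnI2 insertE)
    qed
    fix A B u v
    assume AB: "A \<in> N" "B \<in> N" and uv: "u \<in> A" "v \<in> B" "{u, v} \<in> E"
    then have vu: "{v, u} \<in> E" by (simp add: insert_commute)
    show "A = B \<or> (A \<noteq> Z \<and> B = p A) \<or> (B \<noteq> Z \<and> A = p B)"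
    proof (cases "A = Z \<or> B = Z")
      case True
      then show ?thesis using AB uv vu EZ1 EZ2 unfolding N by blast
    next
      case False
      then consider "A \<in> M1" "B \<in> M1" | "A \<in> M2" "B \<in> M2" | "A \<in> M1" "B \<in> M2" | "A \<in> M2" "B \<in> M1"
        using AB unfolding N by blast
      then have "B = A \<or> B = p A \<or> A = p B"
      proof cases
        case 1 then show ?thesis using E1 uv by blast
      next
        case 2 then show ?thesis using E2 uv by blast
      next
        case 3 then show ?thesis using E12 uv by blast
      next
        case 4 then show ?thesis using E12 uv(1,2) vu by blast
      qed
      then show ?thesis using False by blast
    qed
  qed
  have NZ: "N - {Z} = M1 \<union> M2" using ZM unfolding N by auto
  show thesis
  proof (rule that[OF rp])
    show "children N Z p Z = children N1 Z1 p1 Z1 \<union> children N2 Z2 p2 Z2"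
    proof -
      have "p A = Z \<longleftrightarrow> p1 A = Z1" if "A \<in> M1" for A
        using pM1[OF that] p1_eq[OF that] ZM by auto
      moreover have "p A = Z \<longleftrightarrow> p2 A = Z2" if "A \<in> M2" for A
        using pM2[OF that] p2_eq[OF that] ZM by auto
      ultimately show ?thesis unfolding children_def NZ M1_def[symmetric] M2_def[symmetric] by blast
    qed
    show "children N Z p C = children N1 Z1 p1 C" if "C \<in> N1 - {Z1}" for C
    proof -
      have C: "C \<in> M1" "C \<noteq> Z1" "C \<noteq> Z" using that ZM by (auto simp: M1_def)
      have "p A = C \<longleftrightarrow> p1 A = C" if "A \<in> M1" for A
        using p1_eq[OF that] C by auto
      moreover have "p A \<noteq> C" if "A \<in> M2" for A
        using p2_eq[OF that] pM2[OF that] C M12 by auto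
      ultimately show ?thesis unfolding children_def NZ M1_def[symmetric] M2_def[symmetric] by blast
    qed
    show "children N Z p C = children N2 Z2 p2 C" if "C \<in> N2 - {Z2}" for C
    proof -
      have C: "C \<in> M2" "C \<noteq> Z2" "C \<noteq> Z" using that ZM by (auto simp: M2_def)
      have "p A = C \<longleftrightarrow> p2 A = C" if "A \<in> M2" for A
        using p2_eq[OF that] C by auto
      moreover have "p A \<noteq> C" if "A \<in> M1" for A
        using p1_eq[OF that] pM1[OF that] C M12 by auto
      ultimately show ?thesis unfolding children_def NZ M1_def[symmetric] M2_def[symmetric] by blast
    qed
  qed
qed

text \<open>An injection \<open>g\<close> numbers the bags, which turns the tree of bags into one
  with natural numbers as nodes. The strict bound for non-roots leaves room for the parent
  edge.\<close>

lemma rooted_partition_imp_T_partition: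
  assumes rp: "rooted_partition E V N Z p h"
    and wd: "\<And>C. C \<in> N \<Longrightarrow> card C \<le> w"
    and root: "card (children N Z p Z) \<le> m"
    and nonroot: "\<And>C. C \<in> N - {Z} \<Longrightarrow> card (children N Z p C) < m"
  shows "\<exists>(VT::nat set) ET P. tree VT ET \<and> T_partition V E VT ET P \<and>
    max_degree VT ET \<le> m \<and> partition_width VT P \<le> w"
proof -
  have rt: "rooted_tree N Z p h" and U: "\<Union>N = V" and disj: "disjoint N"
    using rp unfolding rooted_partition_def by auto
  have Z: "Z \<in> N" and px: "\<And>A. A \<in> N \<Longrightarrow> A \<noteq> Z \<Longrightarrow> p A \<in> N \<and> h (p A) < h A" and fin: "finite N"
    using rt unfolding rooted_tree_def by auto
  obtain g :: "'a set \<Rightarrow> nat" where g: "inj_on g N"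
    using finite_imp_inj_to_nat_seg[OF fin] by blast
  define P where "P = inv_into N g"
  have Pg: "P (g A) = A" if "A \<in> N" for A using g that by (simp add: P_def)
  have g_eq: "g A = g B \<longleftrightarrow> A = B" if "A \<in> N" "B \<in> N" for A B
    using inj_on_eq_iff[OF g] that by blast
  define q where "q = (\<lambda>n. g (p (P n)))"
  let ?T = "g ` N" and ?F = "parent_edges (g ` N) (g Z) q"
  have q: "q (g A) = g (p A)" if "A \<in> N" for A using Pg[OF that] by (simp add: q_def)
  have rt': "rooted_tree ?T (g Z) q (\<lambda>n. h (P n))"
  proof -
    have "p A \<in> N" "h (p A) < h A" if "A \<in> N" "g A \<noteq> g Z" for A
      using px[of A] that by auto
    then show ?thesis unfolding rooted_tree_def using fin Z by (auto simp: q Pg)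
  qed
  have ch: "children ?T (g Z) q (g C) = g ` children N Z p C" if "C \<in> N" for C
  proof -
    have "q (g A) = g C \<longleftrightarrow> p A = C" if "A \<in> N - {Z}" for A
      using px[of A] that \<open>C \<in> N\<close> by (simp add: q g_eq)
    then show ?thesis unfolding children_def using Z by (auto simp: g_eq)
  qed
  have deg: "degree ?F (g C) \<le> m" if "C \<in> N" for C
  proof -
    have "finite (children N Z p C)" using fin by (simp add: children_def)
    then have "card (children ?T (g Z) q (g C)) \<le> card (children N Z p C)"
      unfolding ch[OF that] by (rule card_image_le)
    then show ?thesis
      using degree_parent_edges[of ?T "g Z" q "g C"] fin root nonroot[of C] that Z
      by (auto simp: g_eq split: if_splits)
  qed
  have "T_partition V E ?T ?F P"
    unfolding T_partition_def
  proof (intro conjI)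
    show "\<forall>x\<in>?T. \<forall>y\<in>?T. x \<noteq> y \<longrightarrow> P x \<inter> P y = {}"
      using disj by (auto simp: Pg g_eq disjoint_def)
    show "(\<Union>x\<in>?T. P x) = V" using U by (auto simp: Pg)
    show "\<forall>v w x y. {v, w} \<in> E \<longrightarrow> x \<in> ?T \<longrightarrow> y \<in> ?T \<longrightarrow> v \<in> P x \<longrightarrow> w \<in> P y \<longrightarrow>
        x = y \<or> {x, y} \<in> ?F"
    proof (intro allI impI)
      fix v w x y
      assume e: "{v, w} \<in> E" and "x \<in> ?T" "y \<in> ?T" and vw: "v \<in> P x" "w \<in> P y"
      then obtain A B where AB: "A \<in> N" "B \<in> N" "x = g A" "y = g B" by auto
      then have "v \<in> A" "w \<in> B" using vw by (auto simp: Pg)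
      then have "A = B \<or> (A \<noteq> Z \<and> B = p A) \<or> (B \<noteq> Z \<and> A = p B)"
        using rooted_partition_edge[OF rp AB(1,2)] e by blast
      then show "x = y \<or> {x, y} \<in> ?F"
        using AB Z by (auto simp: parent_edges_iff q g_eq)
    qed
  qed
  moreover have "max_degree ?T ?F \<le> m"
    unfolding max_degree_def using fin Z deg by (subst Max_le_iff) auto
  moreover have "partition_width ?T P \<le> w"
    unfolding partition_width_def using fin Z wd by (subst Max_le_iff) (auto simp: Pg)
  ultimately show ?thesis using tree_parent_edges[OF rt'] by blast
qed

section \<open>The induction\<close>

text \<open>The inequalities are cleared of fractions and of truncating subtraction. For
  \<open>card S = 12 * (k * d)\<close> the two root bounds become those of the other bags, namely
  18kd - 2k vertices and 6d - 1 children. Hence a root obtained by induction may become an inner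
  bag.\<close>

definition bounded_partition :: "'a set set \<Rightarrow> nat \<Rightarrow> nat \<Rightarrow> 'a set \<Rightarrow> 'a set \<Rightarrow> 'a set set \<Rightarrow> 'a set
    \<Rightarrow> ('a set \<Rightarrow> 'a set) \<Rightarrow> ('a set \<Rightarrow> nat) \<Rightarrow> bool" where
  "bounded_partition E k d U S N Z p h \<longleftrightarrow>
    rooted_partition E U N Z p h \<and> S \<subseteq> Z \<and> 2 * card Z + 4 * k \<le> 3 * card S \<and>
    2 * k * (card (children N Z p Z) + 1) \<le> card S \<and>
    (\<forall>C\<in>N - {Z}. card C + 2 * k \<le> 18 * (k * d) \<and> card (children N Z p C) < 6 * d)"

text \<open>The hypothesis \<open>sep\<close> provides separations of the whole graph for every
  \<open>S\<close>. They are simply intersected with \<open>U\<close>, so induced subgraphs need no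
  tree decompositions of their own.\<close>

lemma ex_bounded_partition:
  fixes k d :: nat
  assumes k: "1 \<le> k" and d: "1 \<le> d" and finV: "finite V"
    and sep: "\<forall>S\<subseteq>V. \<exists>A A'. A \<union> A' = V \<and> card (A \<inter> A') \<le> k \<and>
      3 * card (S - A) \<le> 2 * card S \<and> 3 * card (S - A') \<le> 2 * card S \<and>
      (\<forall>u v. {u, v} \<in> E \<longrightarrow> u \<in> A - A' \<longrightarrow> v \<notin> A' - A)"
    and deg: "\<forall>v\<in>V. card {w \<in> V. {v, w} \<in> E} \<le> d"
    and "U \<subseteq> V" "S \<subseteq> U" "4 * k \<le> card S" "card S \<le> 12 * (k * d)"
  shows "\<exists>N Z p h. bounded_partition E k d U S N Z p h"
  using assms(6-9)
proof (induction "card U" arbitrary: U S rule: less_induct)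
  case less
  note UV = less.prems(1) and SU = less.prems(2) and lo = less.prems(3) and hi = less.prems(4)
  have finU: "finite U" and finS: "finite S"
    using finV UV SU by (auto intro: finite_subset)
  have Sne: "S \<noteq> {}" using lo k by auto
  have kd: "k \<le> k * d" using d by simp
  consider (small) "card (U - S) + 2 * k \<le> 18 * (k * d)"
    | (light) "18 * (k * d) < card (U - S) + 2 * k" "card S \<le> 12 * k"
    | (heavy) "12 * k < card S"
    by linarith
  then show ?case
  proof cases
    case small
    have triv: "children {C} C p C' = {}" for C C' :: "'a set" and p
      by (auto simp: children_def)
    show ?thesis
    proof (cases "U = S")
      case True
      have "rooted_partition E U {S} S id (\<lambda>_. 0)"
        using rooted_partition_single[OF Sne] True by simp
      then show ?thesis
        using lo by (intro exI[of _ "{S}"] exI[of _ S] exI[of _ id] exI[of _ "\<lambda>_. 0"]) (simp add: triv bounded_partition_def)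
    next
      case False
      let ?C = "U - S"
      have "?C \<noteq> {}" using False SU by auto
      then have rp0: "rooted_partition E ?C {?C} ?C id (\<lambda>_. 0)"
        by (rule rooted_partition_single)
      note add = rooted_partition_add_root[OF rp0 Sne]
      let ?N = "insert S {?C}" and ?p = "id(?C := S)"
        and ?h = "\<lambda>A. if A = S then 0 else Suc ((\<lambda>_. 0) A)"
      have "rooted_partition E (S \<union> ?C) ?N S ?p ?h" by (rule add(1)) auto
      moreover have "S \<union> ?C = U" using SU by auto
      ultimately have rp: "rooted_partition E U ?N S ?p ?h" by simp
      have root: "children ?N S ?p S = {?C}" by (rule add(2)) auto
      have leaf: "children ?N S ?p ?C = {}"
        using add(3)[of ?C] triv by auto
      show ?thesis
        unfolding bounded_partition_def
      proof (intro exI conjI)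
        show "rooted_partition E U ?N S ?p ?h" by (rule rp)
        \<comment> \<open>With root bag \<open>S\<close> and a single child, this condition and the
          next both amount to \<open>4 * k \<le> card S\<close>, which explains the lower bound on
          \<open>S\<close>.\<close>
        show "2 * card S + 4 * k \<le> 3 * card S" using lo by simp
        show "2 * k * (card (children ?N S ?p S) + 1) \<le> card S" unfolding root using lo by simp
        show "\<forall>C\<in>?N - {S}. card C + 2 * k \<le> 18 * (k * d) \<and> card (children ?N S ?p C) < 6 * d"
          using leaf small d by auto
      qed simp
    qed
  next
    case light
    define W where "W = {v \<in> U - S. \<exists>u\<in>S. {u, v} \<in> E}"
    have "card W \<le> card (\<Union>u\<in>S. {w \<in> V. {u, w} \<in> E})"
      using UV finS finV by (intro card_mono) (auto simp: W_def)
    also have "\<dots> \<le> (\<Sum>u\<in>S. card {w \<in> V. {u, w} \<in> E})"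
      by (rule card_UN_le[OF finS])
    also have "\<dots> \<le> of_nat (card S) * d"
      using deg SU UV by (intro sum_bounded_above) auto
    also have "\<dots> \<le> 12 * k * d" using light(2) by simp
    finally have W: "card W \<le> 12 * (k * d)" by simp
    \<comment> \<open>A small neighbourhood can be padded: outside the first case more than 18kd -
      2k, hence at least 4k, vertices lie outside \<open>S\<close>.\<close>
    have "\<exists>S'. W \<subseteq> S' \<and> S' \<subseteq> U - S \<and> 4 * k \<le> card S' \<and> card S' \<le> 12 * (k * d)"
    proof (cases "4 * k \<le> card W")
      case True
      then show ?thesis using W by (intro exI[of _ W]) (auto simp: W_def)
    next
      case False
      moreover have "4 * k \<le> card (U - S)" using light(1) kd by linarith
      moreover have "W \<subseteq> U - S" by (auto simp: W_def)
      ultimately obtain S' where "W \<subseteq> S'" "S' \<subseteq> U - S" "card S' = 4 * k"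
        using exists_subset_between[of W "4 * k" "U - S"] finU by auto
      then show ?thesis using kd by (intro exI[of _ S']) auto
    qed
    then obtain S' where WS': "W \<subseteq> S'" and S': "S' \<subseteq> U - S" "4 * k \<le> card S'" "card S' \<le> 12 * (k * d)"
      by blast
    have less_card: "card (U - S) < card U"
      using finU SU Sne by (intro psubset_card_mono) auto
    have sub: "U - S \<subseteq> V" using UV by auto
    obtain N Z p h where "bounded_partition E k d (U - S) S' N Z p h"
      using less.hyps[OF less_card sub S'] by blast
    then have rp0: "rooted_partition E (U - S) N Z p h" and S'Z: "S' \<subseteq> Z"
      and cZ: "2 * card Z + 4 * k \<le> 3 * card S'"
      and chZ: "2 * k * (card (children N Z p Z) + 1) \<le> card S'"
      and oth: "\<forall>C\<in>N - {Z}. card C + 2 * k \<le> 18 * (k * d) \<and> card (children N Z p C) < 6 * d"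
      unfolding bounded_partition_def by auto
    have nb: "\<forall>u\<in>S. \<forall>v\<in>U - S. {u, v} \<in> E \<longrightarrow> v \<in> Z"
      using WS' S'Z by (auto simp: W_def)
    let ?N = "insert S N" and ?p = "p(Z := S)" and ?h = "\<lambda>A. if A = S then 0 else Suc (h A)"
    have disj: "S \<inter> (U - S) = {}" by auto
    note add = rooted_partition_add_root[OF rp0 Sne disj nb]
    have "S \<union> (U - S) = U" using SU by auto
    then have rp: "rooted_partition E U ?N S ?p ?h" using add(1) by simp
    \<comment> \<open>The old root becomes an inner bag: 2k(c + 1) is at most 12kd for its number c
      of children, so c < 6d.\<close>
    have "2 * k * (card (children N Z p Z) + 1) \<le> 2 * k * (6 * d)"
      using chZ S'(3) by simp
    then have chZ': "card (children N Z p Z) < 6 * d"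
      using k unfolding mult_le_cancel1 by simp
    have cZ': "card Z + 2 * k \<le> 18 * (k * d)" using cZ S'(3) by linarith
    show ?thesis
      unfolding bounded_partition_def
    proof (intro exI conjI ballI)
      show "rooted_partition E U ?N S ?p ?h" by (rule rp)
      show "2 * card S + 4 * k \<le> 3 * card S" using lo by simp
      show "2 * k * (card (children ?N S ?p S) + 1) \<le> card S" unfolding add(2) using lo by simp
      fix C assume "C \<in> ?N - {S}"
      then have C: "C \<in> N" by auto
      then show "card C + 2 * k \<le> 18 * (k * d)" using cZ' oth by (cases "C = Z") auto
      show "card (children ?N S ?p C) < 6 * d"
        unfolding add(3)[OF C] using C chZ' oth by (cases "C = Z") auto
    qed simp
  next
    case heavy
    obtain A A' where AA: "A \<union> A' = V" "card (A \<inter> A') \<le> k"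
      and bal: "3 * card (S - A) \<le> 2 * card S" "3 * card (S - A') \<le> 2 * card S"
      and noedge: "\<And>u v. {u, v} \<in> E \<Longrightarrow> u \<in> A - A' \<Longrightarrow> v \<notin> A' - A"
      using sep[rule_format, OF subset_trans[OF SU UV]] by blast
    \<comment> \<open>The whole separator within \<open>U\<close> joins both \<open>S1\<close> and
      \<open>S2\<close>. Thus both root bags contain it, as gluing requires.\<close>
    define X where "X = A \<inter> A' \<inter> U"
    define S1 where "S1 = S \<inter> A \<union> X"
    define S2 where "S2 = S \<inter> A' \<union> X"
    have SV: "S \<subseteq> A \<union> A'" using SU UV AA(1) by auto
    have X: "card X \<le> k"
      using AA finV by (auto simp: X_def intro!: order_trans[OF card_mono AA(2)] intro: finite_subset)
    have finX: "finite X" using finU by (simp add: X_def)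
    have S1_le: "card S1 \<le> card (S - A') + card X"
    proof -
      have "S1 = (S - A') \<union> X" using SV SU by (auto simp: S1_def X_def)
      then show ?thesis using card_Un_le by metis
    qed
    have S2_le: "card S2 \<le> card (S - A) + card X"
    proof -
      have "S2 = (S - A) \<union> X" using SV SU by (auto simp: S2_def X_def)
      then show ?thesis using card_Un_le by metis
    qed
    have S1_ge: "card S \<le> card S1 + card (S - A)"
    proof -
      have "card S \<le> card (S1 \<union> (S - A))"
        using finS finX by (intro card_mono) (auto simp: S1_def)
      then show ?thesis using card_Un_le order_trans by blast
    qed
    have S2_ge: "card S \<le> card S2 + card (S - A')"
    proof -
      have "card S \<le> card (S2 \<union> (S - A'))"
        using finS finX by (intro card_mono) (auto simp: S2_def)
      then show ?thesis using card_Un_le order_trans by blast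
    qed
    have split: "card (S - A) + card (S - A') \<le> card S"
    proof -
      have "card ((S - A) \<union> (S - A')) = card (S - A) + card (S - A')"
        using finS SV by (intro card_Un_disjoint) auto
      moreover have "card ((S - A) \<union> (S - A')) \<le> card S"
        using finS by (intro card_mono) auto
      ultimately show ?thesis by simp
    qed
    \<comment> \<open>Otherwise |S| is at most |S1|, hence at most 2|S|/3 + k, contradicting |S| >
      12k. So \<open>A \<inter> U\<close> misses a vertex of \<open>U\<close> and the induction
      hypothesis applies.\<close>
    have "S - A \<noteq> {}"
    proof
      assume "S - A = {}"
      then have "card (S - A) = 0" by (metis card.empty)
      then show False using S1_ge S1_le bal X heavy by linarith
    qed
    then have less1: "card (A \<inter> U) < card U"
      using finU SU by (intro psubset_card_mono) auto
    have "S - A' \<noteq> {}"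
    proof
      assume "S - A' = {}"
      then have "card (S - A') = 0" by (metis card.empty)
      then show False using S2_ge S2_le bal X heavy by linarith
    qed
    then have less2: "card (A' \<inter> U) < card U"
      using finU SU by (intro psubset_card_mono) auto
    \<comment> \<open>The threshold 12k gives |S1| at least |S|/3, hence more than 4k. From above,
      |S1| is at most 2|S|/3 + k, hence at most 8kd + k.\<close>
    have S1: "S1 \<subseteq> A \<inter> U" "4 * k \<le> card S1" "card S1 \<le> 12 * (k * d)"
    proof -
      show "S1 \<subseteq> A \<inter> U" using SU by (auto simp: S1_def X_def)
      show "4 * k \<le> card S1" using S1_ge bal heavy by linarith
      show "card S1 \<le> 12 * (k * d)" using S1_le bal X hi kd by linarith
    qed
    have S2: "S2 \<subseteq> A' \<inter> U" "4 * k \<le> card S2" "card S2 \<le> 12 * (k * d)"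
    proof -
      show "S2 \<subseteq> A' \<inter> U" using SU by (auto simp: S2_def X_def)
      show "4 * k \<le> card S2" using S2_ge bal heavy by linarith
      show "card S2 \<le> 12 * (k * d)" using S2_le bal X hi kd by linarith
    qed
    have sub: "A \<inter> U \<subseteq> V" "A' \<inter> U \<subseteq> V" using UV by auto
    obtain N1 Z1 p1 h1 where "bounded_partition E k d (A \<inter> U) S1 N1 Z1 p1 h1"
      using less.hyps[OF less1 sub(1) S1] by blast
    then have rp1: "rooted_partition E (A \<inter> U) N1 Z1 p1 h1" and SZ1: "S1 \<subseteq> Z1"
      and cZ1: "2 * card Z1 + 4 * k \<le> 3 * card S1"
      and ch1: "2 * k * (card (children N1 Z1 p1 Z1) + 1) \<le> card S1"
      and oth1: "\<forall>C\<in>N1 - {Z1}.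
        card C + 2 * k \<le> 18 * (k * d) \<and> card (children N1 Z1 p1 C) < 6 * d"
      unfolding bounded_partition_def by auto
    obtain N2 Z2 p2 h2 where "bounded_partition E k d (A' \<inter> U) S2 N2 Z2 p2 h2"
      using less.hyps[OF less2 sub(2) S2] by blast
    then have rp2: "rooted_partition E (A' \<inter> U) N2 Z2 p2 h2" and SZ2: "S2 \<subseteq> Z2"
      and cZ2: "2 * card Z2 + 4 * k \<le> 3 * card S2"
      and ch2: "2 * k * (card (children N2 Z2 p2 Z2) + 1) \<le> card S2"
      and oth2: "\<forall>C\<in>N2 - {Z2}.
        card C + 2 * k \<le> 18 * (k * d) \<and> card (children N2 Z2 p2 C) < 6 * d"
      unfolding bounded_partition_def by auto
    have meet: "(A \<inter> U) \<inter> (A' \<inter> U) \<subseteq> Z1 \<inter> Z2"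
      using SZ1 SZ2 by (auto simp: S1_def S2_def X_def)
    have cut: "\<forall>u\<in>A \<inter> U - A' \<inter> U. \<forall>v\<in>A' \<inter> U - A \<inter> U. {u, v} \<notin> E"
      using noedge by blast
    let ?Z = "Z1 \<union> Z2"
    let ?N = "insert ?Z ((N1 - {Z1}) \<union> (N2 - {Z2}))"
    obtain p h where rp0: "rooted_partition E (A \<inter> U \<union> A' \<inter> U) ?N ?Z p h"
      and chZ: "children ?N ?Z p ?Z = children N1 Z1 p1 Z1 \<union> children N2 Z2 p2 Z2"
      and chC: "\<And>C. C \<in> N1 - {Z1} \<Longrightarrow> children ?N ?Z p C = children N1 Z1 p1 C"
        "\<And>C. C \<in> N2 - {Z2} \<Longrightarrow> children ?N ?Z p C = children N2 Z2 p2 C"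
      using rooted_partition_glue[OF rp1 rp2 meet cut] by blast
    have "A \<inter> U \<union> A' \<inter> U = U" using UV AA(1) by auto
    then have rp: "rooted_partition E U ?N ?Z p h" using rp0 by simp
    show ?thesis
      unfolding bounded_partition_def
    proof (intro exI conjI ballI)
      show "rooted_partition E U ?N ?Z p h" by (rule rp)
      show "S \<subseteq> ?Z" using SZ1 SZ2 SV by (auto simp: S1_def S2_def)
      have "finite Z1" "finite Z2"
        using rooted_partition_root_subset[OF rp1] rooted_partition_root_subset[OF rp2] finU
        by (auto intro: finite_subset)
      \<comment> \<open>Adding the two root bounds and counting the overlap once gives 2|Z| + 2|X| +
        8k at most 3(|S1| + |S2|), which is at most 3|S| + 6|X|. Since |X| is at most k, one of the
        two terms 4k survives.\<close>
      then have "card ?Z + card (Z1 \<inter> Z2) = card Z1 + card Z2" "card X \<le> card (Z1 \<inter> Z2)"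
        using SZ1 SZ2 card_Un_Int[of Z1 Z2] by (auto simp: S1_def S2_def intro!: card_mono)
      then show "2 * card ?Z + 4 * k \<le> 3 * card S"
        using cZ1 cZ2 S1_le S2_le split X by linarith
      have "card (children ?N ?Z p ?Z) \<le> card (children N1 Z1 p1 Z1) + card (children N2 Z2 p2 Z2)"
        unfolding chZ by (rule card_Un_le)
      then have "2 * k * (card (children ?N ?Z p ?Z) + 1)
          \<le> 2 * k * (card (children N1 Z1 p1 Z1) + card (children N2 Z2 p2 Z2) + 1)"
        by (intro mult_le_mono) auto
      \<comment> \<open>The subtraction does not truncate. The 2k gained by merging two roots into
        one pays for the at most 2k by which |S1| + |S2| may exceed |S|.\<close>
      also have "\<dots> = 2 * k * (card (children N1 Z1 p1 Z1) + 1)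
          + 2 * k * (card (children N2 Z2 p2 Z2) + 1) - 2 * k"
        by (simp add: algebra_simps)
      also have "\<dots> \<le> card S"
        using ch1 ch2 S1_le S2_le split X by linarith
      finally show "2 * k * (card (children ?N ?Z p ?Z) + 1) \<le> card S" .
      fix C assume "C \<in> ?N - {?Z}"
      then consider "C \<in> N1 - {Z1}" | "C \<in> N2 - {Z2}" by blast
      then have "card C + 2 * k \<le> 18 * (k * d) \<and> card (children ?N ?Z p C) < 6 * d"
      proof cases
        case 1
        then show ?thesis unfolding chC(1)[OF 1] using oth1 by blast
      next
        case 2
        then show ?thesis unfolding chC(2)[OF 2] using oth2 by blast
      qed
      then show "card C + 2 * k \<le> 18 * (k * d)" "card (children ?N ?Z p C) < 6 * d" by auto
    qed
  qed
qed

section \<open>From the induction to the theorem\<close>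

lemma treewidth_tree_decomposition:
  assumes "graph V E"
  obtains VT :: "nat set" and ET B where "tree_decomposition V E VT ET B"
    "\<forall>x\<in>VT. card (B x) \<le> treewidth V E + 1"
proof -
  let ?P = "\<lambda>k. \<exists>(VT::nat set) ET B.
      tree_decomposition V E VT ET B \<and> (\<forall>x\<in>VT. card (B x) \<le> k + 1)"
  \<comment> \<open>A single node with bag \<open>V\<close> shows that some width is possible, so
    the \<open>LEAST\<close> in \<open>treewidth\<close> is attained.\<close>
  have "tree {0::nat} {}"
    using tree_parent_edges[of "{0::nat}" 0 id id] by (simp add: rooted_tree_def parent_edges_def)
  then have "tree_decomposition V E {0::nat} {} (\<lambda>_. V)"
    using assms unfolding tree_decomposition_def graph_def connected_on_def by auto
  then have "?P (card V)"
    by (intro exI[of _ "{0}"] exI[of _ "{}"] exI[of _ "\<lambda>_. V"]) auto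
  then have "?P (treewidth V E)"
    unfolding treewidth_def by (rule LeastI)
  then show thesis using that by blast
qed

lemma card_neighbours_le_degree:
  assumes "finite E"
  shows "card {w \<in> V. {v, w} \<in> E} \<le> degree E v"
proof -
  have "inj_on (\<lambda>w. {v, w}) {w \<in> V. {v, w} \<in> E}"
    by (auto simp: inj_on_def doubleton_eq_iff)
  then show ?thesis
    unfolding degree_def using assms by (intro card_inj_on_le) auto
qed

theorem theorem6:
  fixes V :: "'a set" and E :: "'a set set"
  assumes "graph V E" and "E \<noteq> {}"
  shows "\<exists>(VT::nat set) ET P. tree VT ET \<and> T_partition V E VT ET P \<and>
           max_degree VT ET \<le> 6 * max_degree V E \<and>
           partition_width VT P \<le> 2 * (treewidth V E + 1) * (9 * max_degree V E - 1)"
proof -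
  define k where "k = treewidth V E + 1"
  define d where "d = max_degree V E"
  have finV: "finite V" using assms(1) by (simp add: graph_def)
  have "E \<subseteq> Pow V" using assms(1) by (auto simp: graph_def)
  then have finE: "finite E" using finV by (meson finite_Pow_iff finite_subset)
  have deg: "degree E v \<le> d" if "v \<in> V" for v
    using finV that by (simp add: d_def max_degree_def)
  obtain e u where e: "e \<in> E" "u \<in> e" "u \<in> V"
    using assms unfolding graph_def by blast
  then have "degree E u \<noteq> 0"
    using finE by (auto simp: degree_def)
  then have d: "1 \<le> d" using deg[OF e(3)] by simp
  have k: "1 \<le> k" by (simp add: k_def)
  have kd: "k \<le> k * d" using d by simp
  \<comment> \<open>The bound 18kd - 2k on the bags is exactly 2k(9d - 1).\<close>
  have width: "c \<le> 2 * k * (9 * d - 1)" if "c + 2 * k \<le> 18 * (k * d)" for c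
    using that by (simp add: diff_mult_distrib2 mult.assoc)
  have conclude: ?thesis
    if rp: "rooted_partition E V N Z p h"
      and wd: "\<And>C. C \<in> N \<Longrightarrow> card C + 2 * k \<le> 18 * (k * d)"
      and root: "card (children N Z p Z) \<le> 6 * d"
      and nonroot: "\<And>C. C \<in> N - {Z} \<Longrightarrow> card (children N Z p C) < 6 * d" for N Z p h
    using rooted_partition_imp_T_partition[OF rp width[OF wd] root nonroot]
    unfolding k_def d_def .
  show ?thesis
  proof (cases "card V < 4 * k")
    \<comment> \<open>There are too few vertices for a starting set of size 4k, but one bag
      suffices: |V| + 2k < 6k.\<close>
    case True
    have "rooted_partition E V {V} V id (\<lambda>_. 0)"
      using e by (intro rooted_partition_single) auto
    moreover have "card V + 2 * k \<le> 18 * (k * d)" using True kd by linarith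
    ultimately show ?thesis
      using d by (intro conclude) (auto simp: children_def)
  next
    case False
    \<comment> \<open>Any 4k vertices will do. The root bag then has at most 4k vertices and at most
      one child.\<close>
    then obtain S where S: "S \<subseteq> V" "card S = 4 * k"
      using obtain_subset_with_card_n[of "4 * k" V] by (metis not_less)
    obtain VT :: "nat set" and ET B where td: "tree_decomposition V E VT ET B"
      "\<forall>x\<in>VT. card (B x) \<le> k"
      using treewidth_tree_decomposition[OF assms(1)] unfolding k_def .
    have sep: "\<forall>S\<subseteq>V. \<exists>A A'. A \<union> A' = V \<and> card (A \<inter> A') \<le> k \<and>
      3 * card (S - A) \<le> 2 * card S \<and> 3 * card (S - A') \<le> 2 * card S \<and>
      (\<forall>u v. {u, v} \<in> E \<longrightarrow> u \<in> A - A' \<longrightarrow> v \<notin> A' - A)"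
    proof (intro allI impI)
      fix S assume "S \<subseteq> V"
      from tree_decomposition_separation[OF td finV this]
      show "\<exists>A A'. A \<union> A' = V \<and> card (A \<inter> A') \<le> k \<and>
        3 * card (S - A) \<le> 2 * card S \<and> 3 * card (S - A') \<le> 2 * card S \<and>
        (\<forall>u v. {u, v} \<in> E \<longrightarrow> u \<in> A - A' \<longrightarrow> v \<notin> A' - A)"
        by metis
    qed
    have nb: "\<forall>v\<in>V. card {w \<in> V. {v, w} \<in> E} \<le> d"
      using card_neighbours_le_degree[OF finE] deg order_trans by blast
    obtain N Z p h where "bounded_partition E k d V S N Z p h"
      using ex_bounded_partition[OF k d finV sep nb subset_refl S(1)] S(2) kd by auto
    then have rp: "rooted_partition E V N Z p h"
      and cZ: "2 * card Z + 4 * k \<le> 3 * card S"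
      and chZ: "2 * k * (card (children N Z p Z) + 1) \<le> card S"
      and oth: "\<forall>C\<in>N - {Z}. card C + 2 * k \<le> 18 * (k * d) \<and> card (children N Z p C) < 6 * d"
      unfolding bounded_partition_def by auto
    have "card Z + 2 * k \<le> 18 * (k * d)" using cZ S(2) kd by linarith
    then have wd: "card C + 2 * k \<le> 18 * (k * d)" if "C \<in> N" for C
      using oth that by (cases "C = Z") auto
    have "2 * k * (card (children N Z p Z) + 1) \<le> 2 * k * 2"
      using chZ S(2) by simp
    then have root: "card (children N Z p Z) \<le> 6 * d"
      using k d unfolding mult_le_cancel1 by simp
    show ?thesis
      using rp wd root by (rule conclude) (use oth in auto)
  qed
qed

end
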